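(* Let $\alpha\in(0,1)$ and $U=\prod_{i=1}^d[0,b_i]\subset\mathbb{R}^d$ with all $b_i>0$. Assume that the base point $p\in U$ is an interior point in the sense that $p_i>0$ for all $i=1,\dots,d$. Then each element $v=\sum_{i=1}^d c_i\,e_i^\alpha(p)\in T_p^\alpha U$ defines a linear functional $$v:\mathcal{A}^\alpha(U)\to\mathbb{R},\qquad v(f):=\sum_{i=1}^d c_i\,(\partial_{C,i}^\alpha f)(p).$$ Moreover, the map $T_p^\alpha U\to(\mathcal{A}^\alpha(U))^*$, $v\mapsto v(\,\cdot\,)$, is injective. Equivalently, the functionals $f\mapsto(\partial_{C,i}^\alpha f)(p)$, $i=1,\dots,d$, are linearly independent on $\mathcal{A}^\alpha(U)$.
   Context: For $f\in C(U)$ (real-valued continuous functions) the left Riemann--Liouville integral of order $\alpha$ in the $i$-th variable is $$(I_i^\alpha f)(x)=\frac{1}{\Gamma(\alpha)}\int_0^{x_i}(x_i-\xi)^{\alpha-1}f(x_1,\dots,x_{i-1},\xi,x_{i+1},\dots,x_d)\,d\xi.$$ Define $\mathcal{A}_i^\alpha(U)=\{f\in C(U):\exists h_i\in C(U),\ f=I_i^\alpha h_i\}$ and the common anchored space $\mathcal{A}^\alpha(U)=\bigcap_{i=1}^d\mathcal{A}_i^\alpha(U)$; these are real vector spaces. For $f\in\mathcal{A}_i^\alpha(U)$ the function $h_i\in C(U)$ with $f=I_i^\alpha h_i$ is unique, and the coordinatewise anchored Caputo derivative is $\partial_{C,i}^\alpha f:=h_i\in C(U)$. An $i$-th fractional derivation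 of order $\alpha$ at $p$ is a linear map $D_i:\mathcal{A}_i^\alpha(U)\to\mathbb{R}$ for which there is $\lambda_i(D_i)\in\mathbb{R}$ with $D_i(I_i^\alpha h)=\lambda_i(D_i)h(p)$ for every $h\in C(U)$; $\mathfrak{D}_i^\alpha(p)$ is the vector space of all of these. It is one-dimensional, spanned by $(\partial_{C,i}^\alpha)|_p: f\mapsto(\partial_{C,i}^\alpha f)(p)$. The fractional tangent space is the (external) direct sum $T_p^\alpha U=\bigoplus_{i=1}^d\mathfrak{D}_i^\alpha(p)$, and $e_i^\alpha(p)\in T_p^\alpha U$ is the element whose $i$-th component is $(\partial_{C,i}^\alpha)|_p$ and whose other components are zero; the $e_i^\alpha(p)$ form a basis of $T_p^\alpha U$. $(\mathcal{A}^\alpha(U))^*$ is the algebraic dual. *)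

theory Defs
  imports "HOL-Analysis.Analysis" "HOL-Library.Function_Algebras"
begin

text \<open>Pointwise scalar multiplication; \<open>Function_Algebras\<close> provides the pointwise sum.\<close>

instantiation "fun" :: (type, real_vector) real_vector
begin

definition scaleR_fun: "c *\<^sub>R f = (\<lambda>x. c *\<^sub>R f x)"

instance
  by standard (auto simp: scaleR_fun plus_fun_def fun_eq_iff algebra_simps)

end

text \<open>
  The dimension is the cardinality of the finite index type \<open>'n\<close>, and the box
  \<open>[0,b\<^sub>1] \<times> \<dots> \<times> [0,b\<^sub>d]\<close> is \<open>cbox 0 b\<close>.

  A function on the box is represented by its extension by zero to the whole space, so that
  equality on the box is equality and \<open>cont_space b\<close> is a linear subspace of the function space.
  Functionals on a subspace \<open>V\<close> of functions are likewise extended by zero outside \<open>V\<close>.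
\<close>

definition cont_space :: "real^'n \<Rightarrow> (real^'n \<Rightarrow> real) set" where
  "cont_space b = {f. continuous_on (cbox 0 b) f \<and> (\<forall>x. x \<notin> cbox 0 b \<longrightarrow> f x = 0)}"

definition RL_integral ::
    "real^'n \<Rightarrow> real \<Rightarrow> 'n \<Rightarrow> (real^'n \<Rightarrow> real) \<Rightarrow> (real^'n \<Rightarrow> real)" where
  "RL_integral b \<alpha> i f = (\<lambda>x. if x \<in> cbox 0 b
     then 1 / Gamma \<alpha> *
       integral {0..x $ i} (\<lambda>\<xi>. (x $ i - \<xi>) powr (\<alpha> - 1) * f (\<chi> j. if j = i then \<xi> else x $ j))
     else 0)"

definition anchored_space :: "real^'n \<Rightarrow> real \<Rightarrow> 'n \<Rightarrow> (real^'n \<Rightarrow> real) set" where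
  "anchored_space b \<alpha> i = {f \<in> cont_space b. \<exists>h \<in> cont_space b. f = RL_integral b \<alpha> i h}"

definition common_anchored_space :: "real^'n \<Rightarrow> real \<Rightarrow> (real^'n \<Rightarrow> real) set" where
  "common_anchored_space b \<alpha> = (\<Inter>i. anchored_space b \<alpha> i)"

text \<open>Meaningful for \<open>f \<in> anchored_space b \<alpha> i\<close>, where \<open>h\<close> exists and is unique.\<close>

definition caputo :: "real^'n \<Rightarrow> real \<Rightarrow> 'n \<Rightarrow> (real^'n \<Rightarrow> real) \<Rightarrow> (real^'n \<Rightarrow> real)" where
  "caputo b \<alpha> i f = (THE h. h \<in> cont_space b \<and> f = RL_integral b \<alpha> i h)"

definition alg_dual :: "('a::real_vector) set \<Rightarrow> ('a \<Rightarrow> real) set" where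
  "alg_dual V = {D. (\<forall>f\<in>V. \<forall>g\<in>V. D (f + g) = D f + D g) \<and>
                    (\<forall>c. \<forall>f\<in>V. D (c *\<^sub>R f) = c * D f) \<and>
                    (\<forall>f. f \<notin> V \<longrightarrow> D f = 0)}"

definition frac_derivations ::
    "real^'n \<Rightarrow> real \<Rightarrow> real^'n \<Rightarrow> 'n \<Rightarrow> ((real^'n \<Rightarrow> real) \<Rightarrow> real) set" where
  "frac_derivations b \<alpha> p i = {D \<in> alg_dual (anchored_space b \<alpha> i).
     \<exists>l. \<forall>h \<in> cont_space b. D (RL_integral b \<alpha> i h) = l * h p}"

definition caputo_at ::
    "real^'n \<Rightarrow> real \<Rightarrow> real^'n \<Rightarrow> 'n \<Rightarrow> ((real^'n \<Rightarrow> real) \<Rightarrow> real)" where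
  "caputo_at b \<alpha> p i = (\<lambda>f. if f \<in> anchored_space b \<alpha> i then caputo b \<alpha> i f p else 0)"

text \<open>The index set is finite, so the external direct sum consists of all families.\<close>

definition tangent_space ::
    "real^'n \<Rightarrow> real \<Rightarrow> real^'n \<Rightarrow> ('n \<Rightarrow> (real^'n \<Rightarrow> real) \<Rightarrow> real) set" where
  "tangent_space b \<alpha> p = {v. \<forall>i. v i \<in> frac_derivations b \<alpha> p i}"

definition tangent_basis ::
    "real^'n \<Rightarrow> real \<Rightarrow> real^'n \<Rightarrow> 'n \<Rightarrow> ('n \<Rightarrow> (real^'n \<Rightarrow> real) \<Rightarrow> real)" where
  "tangent_basis b \<alpha> p i = (\<lambda>j. if j = i then caputo_at b \<alpha> p i else 0)"

definition tangent_coeffs ::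
    "real^'n \<Rightarrow> real \<Rightarrow> real^'n \<Rightarrow> ('n \<Rightarrow> (real^'n \<Rightarrow> real) \<Rightarrow> real) \<Rightarrow> ('n \<Rightarrow> real)" where
  "tangent_coeffs b \<alpha> p v = (THE c. v = (\<Sum>i\<in>UNIV. c i *\<^sub>R tangent_basis b \<alpha> p i))"

definition tangent_functional ::
    "real^'n \<Rightarrow> real \<Rightarrow> real^'n \<Rightarrow> ('n \<Rightarrow> (real^'n \<Rightarrow> real) \<Rightarrow> real) \<Rightarrow> ((real^'n \<Rightarrow> real) \<Rightarrow> real)"
  where
  "tangent_functional b \<alpha> p v = (\<lambda>f. if f \<in> common_anchored_space b \<alpha>
     then \<Sum>i\<in>UNIV. tangent_coeffs b \<alpha> p v i * caputo b \<alpha> i f p else 0)"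

end

theory Submission
  imports Defs
begin

text \<open>
  Independence is witnessed by product functions \<open>f(x) = \<Prod>\<^sub>j g\<^sub>j(x\<^sub>j)\<close> with
  \<open>g\<^sub>j = I\<^sup>\<alpha> \<phi>\<^sub>j\<close> for continuous one-variable functions \<open>\<phi>\<^sub>j\<close>. Such an \<open>f\<close> lies in every
  \<open>\<A>\<^sub>k\<^sup>\<alpha>\<close>, and its \<open>k\<close>-th Caputo derivative replaces the factor \<open>g\<^sub>k\<close> by \<open>\<phi>\<^sub>k\<close>. Given
  an index \<open>i\<close>, take \<open>\<phi>\<^sub>i = 1\<close> and \<open>\<phi>\<^sub>j(\<xi>) = p\<^sub>j - \<xi>\<close> for \<open>j \<noteq> i\<close>. Every Caputo derivative in a
  direction \<open>k \<noteq> i\<close> then contains the factor \<open>\<phi>\<^sub>k(p\<^sub>k) = 0\<close>, whereas the one in direction \<open>i\<close> is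
  \<open>\<Prod>\<^sub>j\<^sub>\<noteq>\<^sub>i g\<^sub>j(p\<^sub>j)\<close> at \<open>p\<close>. That product is positive because \<open>g\<^sub>j(p\<^sub>j)\<close> is a fractional integral
  over \<open>[0, p\<^sub>j]\<close>, an interval of positive length, of a function that is positive on \<open>[0, p\<^sub>j)\<close>.
  So every coefficient of a vanishing combination can be isolated (\<open>exists_dual_function\<close>,
  \<open>caputo_linearly_independent\<close>).

  For this to make sense, the Caputo derivative has to be well defined: \<open>I\<^sub>i\<^sup>\<alpha>\<close> must map continuous
  functions to continuous functions and be injective on them. Both facts are reduced to one
  variable. The substitution \<open>u = ((t - \<xi>) / t)\<^sup>\<alpha>\<close> absorbs the singular kernel
  (\<open>riemann_liouville_rescaled\<close>) and yields linearity, boundedness and continuity. Injectivity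
  follows from \<open>I\<^sup>1\<^sup>-\<^sup>\<alpha> I\<^sup>\<alpha> \<phi> = \<integral> \<phi>\<close> by differentiation; this is a case of the
  semigroup law \<open>I\<^sup>\<beta> I\<^sup>\<alpha> = I\<^sup>\<alpha>\<^sup>+\<^sup>\<beta>\<close>, which a Beta integral gives for monomials and the
  Weierstrass theorem extends to all continuous functions.
\<close>

section \<open>The Riemann--Liouville integral in one variable\<close>

definition riemann_liouville :: "real \<Rightarrow> (real \<Rightarrow> real) \<Rightarrow> real \<Rightarrow> real" where
  "riemann_liouville \<alpha> \<phi> t =
     1 / Gamma \<alpha> * integral {0..t} (\<lambda>\<xi>. (t - \<xi>) powr (\<alpha> - 1) * \<phi> \<xi>)"

lemma riemann_liouville_cong:
  assumes "\<And>\<xi>. 0 \<le> \<xi> \<Longrightarrow> \<xi> \<le> t \<Longrightarrow> \<phi> \<xi> = \<psi> \<xi>"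
  shows "riemann_liouville \<alpha> \<phi> t = riemann_liouville \<alpha> \<psi> t"
  unfolding riemann_liouville_def using assms by (auto intro!: arg_cong[where f = "(*) _"] integral_cong)

lemma riemann_liouville_cmult:
  "riemann_liouville \<alpha> (\<lambda>\<xi>. c * \<phi> \<xi>) t = c * riemann_liouville \<alpha> \<phi> t"
proof -
  have "(\<lambda>\<xi>. (t - \<xi>) powr (\<alpha> - 1) * (c * \<phi> \<xi>)) = (\<lambda>\<xi>. c * ((t - \<xi>) powr (\<alpha> - 1) * \<phi> \<xi>))"
    by (auto simp: algebra_simps)
  then show ?thesis
    by (simp only: riemann_liouville_def integral_mult_right) simp
qed

lemma riemann_liouville_zero_right [simp]: "riemann_liouville \<alpha> \<phi> 0 = 0"
  by (simp add: riemann_liouville_def)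

lemma rescaled_arg_mem:
  assumes "0 < (\<alpha>::real)" "0 \<le> t" "u \<in> {0..1}"
  shows "t * (1 - u powr (1 / \<alpha>)) \<in> {0..t}"
proof -
  have "u powr (1 / \<alpha>) \<le> 1"
    using assms by (intro powr_le1) auto
  then have "1 - u powr (1 / \<alpha>) \<in> {0..1}" by simp
  then show ?thesis using \<open>0 \<le> t\<close> by (auto intro: mult_left_le)
qed

lemma continuous_on_rescaled:
  assumes "0 < (\<alpha>::real)" "0 \<le> t" "continuous_on {0..t} \<phi>"
  shows "continuous_on {0..1} (\<lambda>u. \<phi> (t * (1 - u powr (1 / \<alpha>))))"
proof (rule continuous_on_compose2[OF assms(3)])
  show "continuous_on {0..1} (\<lambda>u. t * (1 - u powr (1 / \<alpha>)))"
    using assms(1) by (intro continuous_intros continuous_on_powr') auto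
  show "(\<lambda>u. t * (1 - u powr (1 / \<alpha>))) ` {0..1} \<subseteq> {0..t}"
    using rescaled_arg_mem[OF assms(1,2)] by blast
qed

text \<open>
  The substitution \<open>u = ((t - \<xi>) / t)\<^sup>\<alpha>\<close>, whose derivative is a multiple of the kernel
  \<open>(t - \<xi>)\<^sup>\<alpha>\<^sup>-\<^sup>1\<close>, trades the singular integrand for a continuous one on an interval that
  does not depend on \<open>t\<close>.
\<close>

lemma riemann_liouville_rescaled:
  assumes "0 < \<alpha>" "0 \<le> t" "continuous_on {0..t} \<phi>"
  shows "riemann_liouville \<alpha> \<phi> t
    = t powr \<alpha> / Gamma (\<alpha> + 1) * integral {0..1} (\<lambda>u. \<phi> (t * (1 - u powr (1 / \<alpha>))))"
proof (cases "t = 0")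
  case False
  with assms have t: "0 < t" by simp
  let ?f = "\<lambda>u. \<phi> (t * (1 - u powr (1 / \<alpha>)))"
  let ?g = "\<lambda>\<xi>. ((t - \<xi>) / t) powr \<alpha>"
  let ?g' = "\<lambda>\<xi>. - (\<alpha> / t) * ((t - \<xi>) / t) powr (\<alpha> - 1)"
  let ?I = "integral {0..1} ?f"
  (* The substitution fails to be differentiable only at the singularity t, which the
     substitution rule tolerates as an exceptional point. It reverses orientation. *)
  have subst: "((\<lambda>\<xi>. ?g' \<xi> *\<^sub>R ?f (?g \<xi>)) has_integral
          (integral {?g 0..?g t} ?f - integral {?g t..?g 0} ?f)) {0..t}"
  proof (rule has_integral_substitution_general[of "{t}" _ _ _ 0 1])
    show "?g ` {0..t} \<subseteq> {0..1}"
    proof clarsimp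
      fix \<xi> assume "0 \<le> \<xi>" "\<xi> \<le> t"
      then show "((t - \<xi>) / t) powr \<alpha> \<le> 1"
        using t assms(1) by (intro powr_le1) auto
    qed
    show "continuous_on {0..1} ?f"
      using assms by (rule continuous_on_rescaled)
    show "continuous_on {0..t} ?g"
      using assms(1) t by (intro continuous_intros continuous_on_powr') auto
    fix \<xi> assume "\<xi> \<in> {0..t} - {t}"
    then have pos: "0 < (t - \<xi>) / t" using t by auto
    show "(?g has_field_derivative ?g' \<xi>) (at \<xi> within {0..t})"
      using t pos by (auto intro!: derivative_eq_intros simp: powr_diff field_simps)
  qed (use t in auto)
  have integrand: "?g' \<xi> *\<^sub>R ?f (?g \<xi>)
      = - (\<alpha> / t powr \<alpha>) * ((t - \<xi>) powr (\<alpha> - 1) * \<phi> \<xi>)" if "\<xi> \<in> {0..t}" for \<xi>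
  proof -
    have "?g \<xi> powr (1 / \<alpha>) = (t - \<xi>) / t"
      using that t assms(1) by (simp add: powr_powr)
    then have "t * (1 - ?g \<xi> powr (1 / \<alpha>)) = \<xi>"
      using t by (simp add: field_simps)
    then have "?f (?g \<xi>) = \<phi> \<xi>" by simp
    moreover have "((t - \<xi>) / t) powr (\<alpha> - 1) = (t - \<xi>) powr (\<alpha> - 1) * t / t powr \<alpha>"
      using that t by (simp add: powr_divide powr_diff)
    ultimately show ?thesis using t by simp
  qed
  have "((\<lambda>\<xi>. - (\<alpha> / t powr \<alpha>) * ((t - \<xi>) powr (\<alpha> - 1) * \<phi> \<xi>))
      has_integral - ?I) {0..t}"
  proof (rule has_integral_eq)
    show "((\<lambda>\<xi>. ?g' \<xi> *\<^sub>R ?f (?g \<xi>)) has_integral - ?I) {0..t}"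
      using subst t by (simp del: real_scaleR_def scaleR_minus_left)
  qed (rule integrand)
  then have "- (\<alpha> / t powr \<alpha>) * integral {0..t} (\<lambda>\<xi>. (t - \<xi>) powr (\<alpha> - 1) * \<phi> \<xi>) = - ?I"
    by (simp only: integral_mult_right[symmetric] integral_unique)
  then have "integral {0..t} (\<lambda>\<xi>. (t - \<xi>) powr (\<alpha> - 1) * \<phi> \<xi>) = t powr \<alpha> / \<alpha> * ?I"
    using t assms(1) by (simp add: field_simps)
  moreover have "Gamma (\<alpha> + 1) = \<alpha> * Gamma \<alpha>"
    using assms(1) by (intro Gamma_plus1) (auto elim!: nonpos_Ints_cases)
  ultimately show ?thesis
    by (simp add: riemann_liouville_def)
qed simp

lemma riemann_liouville_add:
  assumes "0 < \<alpha>" "0 \<le> t" "continuous_on {0..t} \<phi>" "continuous_on {0..t} \<psi>"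
  shows "riemann_liouville \<alpha> (\<lambda>\<xi>. \<phi> \<xi> + \<psi> \<xi>) t
    = riemann_liouville \<alpha> \<phi> t + riemann_liouville \<alpha> \<psi> t"
proof -
  have "continuous_on {0..t} (\<lambda>\<xi>. \<phi> \<xi> + \<psi> \<xi>)"
    using assms by (intro continuous_intros)
  then show ?thesis
    using assms
    by (simp add: riemann_liouville_rescaled integral_add integrable_continuous_interval
        continuous_on_rescaled distrib_left)
qed

lemma riemann_liouville_diff:
  assumes "0 < \<alpha>" "0 \<le> t" "continuous_on {0..t} \<phi>" "continuous_on {0..t} \<psi>"
  shows "riemann_liouville \<alpha> (\<lambda>\<xi>. \<phi> \<xi> - \<psi> \<xi>) t
    = riemann_liouville \<alpha> \<phi> t - riemann_liouville \<alpha> \<psi> t"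
  using riemann_liouville_add[of \<alpha> t \<phi> "\<lambda>\<xi>. (- 1) * \<psi> \<xi>"] riemann_liouville_cmult[of \<alpha> "- 1" \<psi> t] assms
  by (simp add: continuous_on_minus)

lemma riemann_liouville_sum:
  fixes n :: nat
  assumes "0 < \<alpha>" "0 \<le> t" "\<And>k. continuous_on {0..t} (\<phi> k)"
  shows "riemann_liouville \<alpha> (\<lambda>\<xi>. \<Sum>k\<le>n. \<phi> k \<xi>) t = (\<Sum>k\<le>n. riemann_liouville \<alpha> (\<phi> k) t)"
proof (induction n)
  case (Suc n)
  have "continuous_on {0..t} (\<lambda>\<xi>. \<Sum>k\<le>n. \<phi> k \<xi>)"
    using assms(3) by (intro continuous_intros)
  then show ?case
    using Suc assms by (simp add: riemann_liouville_add)
qed simp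

lemma riemann_liouville_bound:
  assumes "0 < \<alpha>" "0 \<le> t" "continuous_on {0..t} \<phi>"
    and "\<And>\<xi>. 0 \<le> \<xi> \<Longrightarrow> \<xi> \<le> t \<Longrightarrow> \<bar>\<phi> \<xi>\<bar> \<le> e"
  shows "\<bar>riemann_liouville \<alpha> \<phi> t\<bar> \<le> t powr \<alpha> / Gamma (\<alpha> + 1) * e"
proof -
  have "norm (integral {0..1} (\<lambda>u. \<phi> (t * (1 - u powr (1 / \<alpha>))))) \<le> e * (1 - 0)"
    using assms rescaled_arg_mem[OF assms(1,2)]
    by (intro integral_bound continuous_on_rescaled) auto
  moreover have "0 < Gamma (\<alpha> + 1)" using assms(1) by (simp add: Gamma_real_pos)
  ultimately show ?thesis
    using assms by (auto simp: riemann_liouville_rescaled abs_mult intro!: mult_left_mono divide_right_mono)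
qed

lemma continuous_on_riemann_liouville:
  assumes "0 < \<alpha>" "continuous_on {0..T} \<phi>"
  shows "continuous_on {0..T} (riemann_liouville \<alpha> \<phi>)"
proof -
  have "continuous_on {0..T} (\<lambda>t. integral (cbox 0 1) (\<lambda>u. \<phi> (t * (1 - u powr (1 / \<alpha>)))))"
  proof (rule integral_continuous_on_param, unfold case_prod_unfold,
      rule continuous_on_compose2[OF assms(2)])
    show "continuous_on ({0..T} \<times> cbox 0 1) (\<lambda>p. fst p * (1 - snd p powr (1 / \<alpha>)))"
      using assms(1) by (intro continuous_intros continuous_on_powr') auto
    show "(\<lambda>p. fst p * (1 - snd p powr (1 / \<alpha>))) ` ({0..T} \<times> cbox 0 1) \<subseteq> {0..T}"
      using rescaled_arg_mem[OF assms(1)] by fastforce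
  qed
  then have "continuous_on {0..T} (\<lambda>t. t powr \<alpha> / Gamma (\<alpha> + 1) *
      integral {0..1} (\<lambda>u. \<phi> (t * (1 - u powr (1 / \<alpha>)))))"
    using assms(1) by (auto intro!: continuous_intros continuous_on_powr' simp: Gamma_real_pos less_imp_neq[symmetric])
  moreover have "continuous_on {0..t} \<phi>" if "t \<le> T" for t
    using assms(2) by (rule continuous_on_subset) (use that in auto)
  ultimately show ?thesis
    using assms(1) by (elim continuous_on_eq) (simp add: riemann_liouville_rescaled)
qed

section \<open>The semigroup law and injectivity\<close>

text \<open>
  Scaling \<open>[0, t]\<close> to \<open>[0, 1]\<close> turns the integral into a power of \<open>t\<close> times the Beta
  integral with parameters \<open>\<nu> + 1\<close> and \<open>\<alpha>\<close>. The point \<open>0\<close> is left out of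
  the hypothesis on \<open>\<phi>\<close> so that \<open>\<phi> \<xi> = \<xi>\<^sup>0\<close> is covered: \<open>0 powr 0 = 0\<close>, but \<open>0 ^ 0 = 1\<close>.
\<close>

lemma riemann_liouville_powr:
  assumes "0 < \<alpha>" "-1 < \<nu>" "0 < t"
    and "\<And>\<xi>. 0 < \<xi> \<Longrightarrow> \<xi> \<le> t \<Longrightarrow> \<phi> \<xi> = \<xi> powr \<nu>"
  shows "riemann_liouville \<alpha> \<phi> t = Gamma (\<nu> + 1) / Gamma (\<nu> + 1 + \<alpha>) * t powr (\<nu> + \<alpha>)"
proof -
  have "((\<lambda>s. s powr \<nu> * (1 - s) powr (\<alpha> - 1)) has_integral Beta (\<nu> + 1) \<alpha>) (cbox 0 1)"
    using has_integral_Beta_real[of "\<nu> + 1" \<alpha>] assms by simp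
  from has_integral_affinity'[OF this, of "1 / t" 0]
  have "((\<lambda>\<xi>. (\<xi> / t) powr \<nu> * (1 - \<xi> / t) powr (\<alpha> - 1)) has_integral Beta (\<nu> + 1) \<alpha> * t) {0..t}"
    using assms(3) by (simp add: field_simps)
  then have "((\<lambda>\<xi>. (\<xi> / t) powr \<nu> * (1 - \<xi> / t) powr (\<alpha> - 1) * t powr (\<nu> + (\<alpha> - 1)))
      has_integral Beta (\<nu> + 1) \<alpha> * t * t powr (\<nu> + (\<alpha> - 1))) {0..t}"
    by (rule has_integral_mult_left)
  then have "((\<lambda>\<xi>. (t - \<xi>) powr (\<alpha> - 1) * \<phi> \<xi>)
      has_integral Beta (\<nu> + 1) \<alpha> * t * t powr (\<nu> + (\<alpha> - 1))) {0..t}"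
  proof (rule has_integral_spike_finite[of "{0}", rotated 2])
    fix \<xi> assume \<xi>: "\<xi> \<in> {0..t} - {0}"
    have "1 - \<xi> / t = (t - \<xi>) / t" using assms(3) by (simp add: field_simps)
    then show "(t - \<xi>) powr (\<alpha> - 1) * \<phi> \<xi>
        = (\<xi> / t) powr \<nu> * (1 - \<xi> / t) powr (\<alpha> - 1) * t powr (\<nu> + (\<alpha> - 1))"
      using \<xi> assms(3,4) by (simp add: powr_divide powr_add)
  qed simp
  moreover have "t * t powr (\<nu> + (\<alpha> - 1)) = t powr (\<nu> + \<alpha>)"
    using powr_mult_base[of t "\<nu> + (\<alpha> - 1)"] assms(3) by (simp add: algebra_simps)
  moreover have "Gamma \<alpha> > 0" using assms(1) by (rule Gamma_real_pos)
  ultimately show ?thesis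
    by (simp add: riemann_liouville_def integral_unique Beta_def mult.assoc)
qed

lemma riemann_liouville_one: "riemann_liouville 1 \<phi> t = integral {0..t} \<phi>"
proof -
  have "integral {0..t} (\<lambda>\<xi>. (t - \<xi>) powr (1 - 1) * \<phi> \<xi>) = integral {0..t} \<phi>"
    by (rule integral_spike[of "{t}"]) auto
  then show ?thesis by (simp add: riemann_liouville_def)
qed

lemma riemann_liouville_power:
  assumes "0 < \<alpha>" "0 \<le> t"
  shows "riemann_liouville \<alpha> (\<lambda>\<xi>. \<xi> ^ n) t
    = Gamma (real n + 1) / Gamma (real n + 1 + \<alpha>) * t powr (real n + \<alpha>)"
proof (cases "t = 0")
  case False
  with assms show ?thesis
    by (intro riemann_liouville_powr) (auto simp: powr_realpow)
qed simp

lemma riemann_liouville_semigroup_power: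
  assumes "0 < \<alpha>" "0 < \<beta>" "0 \<le> t"
  shows "riemann_liouville \<beta> (riemann_liouville \<alpha> (\<lambda>\<xi>. \<xi> ^ n)) t
    = riemann_liouville (\<alpha> + \<beta>) (\<lambda>\<xi>. \<xi> ^ n) t"
proof (cases "t = 0")
  case False
  with assms have t: "0 < t" by simp
  have "riemann_liouville \<beta> (riemann_liouville \<alpha> (\<lambda>\<xi>. \<xi> ^ n)) t
      = riemann_liouville \<beta> (\<lambda>\<xi>. Gamma (real n + 1) / Gamma (real n + 1 + \<alpha>) * \<xi> powr (real n + \<alpha>)) t"
    using assms by (intro riemann_liouville_cong) (simp add: riemann_liouville_power)
  also have "\<dots> = Gamma (real n + 1) / Gamma (real n + 1 + \<alpha>) *
      (Gamma (real n + \<alpha> + 1) / Gamma (real n + \<alpha> + 1 + \<beta>) * t powr (real n + \<alpha> + \<beta>))"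
    using assms t by (simp only: riemann_liouville_cmult, subst riemann_liouville_powr[of \<beta> "real n + \<alpha>"]) auto
  also have "\<dots> = riemann_liouville (\<alpha> + \<beta>) (\<lambda>\<xi>. \<xi> ^ n) t"
  proof -
    have "Gamma (1 + (\<alpha> + real n)) \<noteq> 0"
      using assms by (intro less_imp_neq[symmetric] Gamma_real_pos) auto
    then show ?thesis
      using assms by (simp add: riemann_liouville_power add_ac)
  qed
  finally show ?thesis .
qed simp

text \<open>
  The defect of the law is linear in \<open>\<phi>\<close>, is bounded by a constant times the supremum of
  \<open>\<bar>\<phi>\<bar>\<close> on \<open>[0, t]\<close>, and is zero on polynomials; since polynomials are dense, it is zero.
\<close>

lemma riemann_liouville_semigroup:
  assumes "0 < \<alpha>" "0 < \<beta>" "0 \<le> t" and cont: "continuous_on {0..t} \<phi>"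
  shows "riemann_liouville \<beta> (riemann_liouville \<alpha> \<phi>) t = riemann_liouville (\<alpha> + \<beta>) \<phi> t"
proof -
  define \<Delta> where "\<Delta> \<psi> = riemann_liouville \<beta> (riemann_liouville \<alpha> \<psi>) t
      - riemann_liouville (\<alpha> + \<beta>) \<psi> t" for \<psi>
  define C where "C = t powr \<beta> / Gamma (\<beta> + 1) * (t powr \<alpha> / Gamma (\<alpha> + 1))
      + t powr (\<alpha> + \<beta>) / Gamma (\<alpha> + \<beta> + 1)"
  have sub: "continuous_on {0..s} \<psi>" if "continuous_on {0..t} \<psi>" "s \<le> t" for s and \<psi> :: "real \<Rightarrow> real"
    using that(1) by (rule continuous_on_subset) (use that in auto)
  have C: "0 \<le> C"
    using assms by (auto simp: C_def intro!: add_nonneg_nonneg mult_nonneg_nonneg divide_nonneg_pos Gamma_real_pos)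
  have poly: "\<Delta> (\<lambda>\<xi>. \<Sum>k\<le>n. a k * \<xi> ^ k) = 0" for a :: "nat \<Rightarrow> real" and n
  proof -
    have cont_pow: "continuous_on {0..s} (\<lambda>\<xi>. a k * \<xi> ^ k)" for k s
      by (intro continuous_intros)
    have cont_RL: "continuous_on {0..t} (\<lambda>s. a k * riemann_liouville \<alpha> (\<lambda>\<xi>. \<xi> ^ k) s)" for k
      using assms by (intro continuous_intros continuous_on_riemann_liouville)
    have "riemann_liouville \<beta> (riemann_liouville \<alpha> (\<lambda>\<xi>. \<Sum>k\<le>n. a k * \<xi> ^ k)) t
        = riemann_liouville \<beta> (\<lambda>s. \<Sum>k\<le>n. a k * riemann_liouville \<alpha> (\<lambda>\<xi>. \<xi> ^ k) s) t"
      using assms cont_pow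
      by (intro riemann_liouville_cong)
        (simp add: riemann_liouville_sum[where \<phi> = "\<lambda>k \<xi>. a k * \<xi> ^ k"] riemann_liouville_cmult)
    also have "\<dots> = (\<Sum>k\<le>n. a k * riemann_liouville (\<alpha> + \<beta>) (\<lambda>\<xi>. \<xi> ^ k) t)"
      using assms cont_RL
      by (simp add: riemann_liouville_sum[where \<phi> = "\<lambda>k s. a k * riemann_liouville \<alpha> (\<lambda>\<xi>. \<xi> ^ k) s"]
          riemann_liouville_cmult riemann_liouville_semigroup_power)
    finally show ?thesis
      using assms cont_pow
      by (simp add: \<Delta>_def riemann_liouville_sum[where \<phi> = "\<lambda>k \<xi>. a k * \<xi> ^ k"] riemann_liouville_cmult)
  qed
  have "\<bar>\<Delta> \<phi>\<bar> \<le> 0 + e" if e: "0 < e" for e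
  proof -
    (* C bounds the defect of a function of supremum norm 1; C + 1 avoids a division by zero. *)
    define d where "d = e / (C + 1)"
    have d: "0 < d" using e C by (simp add: d_def)
    obtain q where "real_polynomial_function q" and close: "\<And>\<xi>. \<xi> \<in> {0..t} \<Longrightarrow> \<bar>\<phi> \<xi> - q \<xi>\<bar> < d"
      using Stone_Weierstrass_real_polynomial_function[OF compact_Icc cont d] by blast
    then obtain a n where q: "q = (\<lambda>\<xi>. \<Sum>k\<le>n. a k * \<xi> ^ k)"
      unfolding real_polynomial_function_iff_sum by blast
    have cont_q: "continuous_on {0..t} q"
      unfolding q by (intro continuous_intros)
    have cont_diff: "continuous_on {0..t} (\<lambda>\<xi>. \<phi> \<xi> - q \<xi>)"
      using cont cont_q by (intro continuous_intros)
    have "riemann_liouville \<beta> (riemann_liouville \<alpha> (\<lambda>\<xi>. \<phi> \<xi> - q \<xi>)) t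
        = riemann_liouville \<beta> (\<lambda>s. riemann_liouville \<alpha> \<phi> s - riemann_liouville \<alpha> q s) t"
      using assms(1) by (intro riemann_liouville_cong) (simp add: riemann_liouville_diff sub cont cont_q)
    then have "\<Delta> \<phi> - \<Delta> q = \<Delta> (\<lambda>\<xi>. \<phi> \<xi> - q \<xi>)"
      using assms cont_q
      by (simp add: \<Delta>_def riemann_liouville_diff continuous_on_riemann_liouville)
    then have eq: "\<Delta> \<phi> = \<Delta> (\<lambda>\<xi>. \<phi> \<xi> - q \<xi>)"
      using poly[of a n] by (simp add: q)
    have inner: "\<bar>riemann_liouville \<alpha> (\<lambda>\<xi>. \<phi> \<xi> - q \<xi>) s\<bar> \<le> t powr \<alpha> / Gamma (\<alpha> + 1) * d"
      if "0 \<le> s" "s \<le> t" for s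
    proof -
      have "\<bar>riemann_liouville \<alpha> (\<lambda>\<xi>. \<phi> \<xi> - q \<xi>) s\<bar> \<le> s powr \<alpha> / Gamma (\<alpha> + 1) * d"
        using assms(1) that close by (intro riemann_liouville_bound sub[OF cont_diff]) (auto intro: less_imp_le)
      also have "\<dots> \<le> t powr \<alpha> / Gamma (\<alpha> + 1) * d"
        using that assms(1) d
        by (intro mult_right_mono divide_right_mono powr_mono2) (auto intro!: less_imp_le Gamma_real_pos)
      finally show ?thesis .
    qed
    have "\<bar>riemann_liouville \<beta> (riemann_liouville \<alpha> (\<lambda>\<xi>. \<phi> \<xi> - q \<xi>)) t\<bar>
        \<le> t powr \<beta> / Gamma (\<beta> + 1) * (t powr \<alpha> / Gamma (\<alpha> + 1) * d)"
      using assms inner by (intro riemann_liouville_bound continuous_on_riemann_liouville cont_diff) auto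
    moreover have "\<bar>riemann_liouville (\<alpha> + \<beta>) (\<lambda>\<xi>. \<phi> \<xi> - q \<xi>) t\<bar>
        \<le> t powr (\<alpha> + \<beta>) / Gamma (\<alpha> + \<beta> + 1) * d"
      using assms close by (intro riemann_liouville_bound cont_diff) (auto intro: less_imp_le)
    ultimately have "\<bar>\<Delta> (\<lambda>\<xi>. \<phi> \<xi> - q \<xi>)\<bar> \<le> C * d"
      unfolding \<Delta>_def C_def by (simp add: algebra_simps)
    also have "\<dots> \<le> e"
      using C e by (simp add: d_def field_simps)
    finally show ?thesis by (simp add: eq)
  qed
  then have "\<bar>\<Delta> \<phi>\<bar> \<le> 0" by (rule field_le_epsilon)
  then show ?thesis by (simp add: \<Delta>_def)
qed

text \<open>
  Applying \<open>I\<^sup>1\<^sup>-\<^sup>\<alpha>\<close> to both sides shows that the antiderivatives of \<open>\<phi>\<close> and \<open>\<psi>\<close> agree.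
\<close>

lemma riemann_liouville_inj:
  assumes "0 < \<alpha>" "\<alpha> < 1" "0 < T"
    and "continuous_on {0..T} \<phi>" "continuous_on {0..T} \<psi>"
    and eq: "\<And>t. 0 \<le> t \<Longrightarrow> t \<le> T \<Longrightarrow> riemann_liouville \<alpha> \<phi> t = riemann_liouville \<alpha> \<psi> t"
    and t: "t \<in> {0..T}"
  shows "\<phi> t = \<psi> t"
proof -
  have sub: "continuous_on {0..s} \<phi>" "continuous_on {0..s} \<psi>" if "s \<le> T" for s
    by (rule continuous_on_subset[OF assms(4)] continuous_on_subset[OF assms(5)]; use that in auto)+
  have int_eq: "integral {0..s} \<phi> = integral {0..s} \<psi>" if s: "s \<in> {0..T}" for s
  proof -
    have "integral {0..s} \<phi> = riemann_liouville (1 - \<alpha>) (riemann_liouville \<alpha> \<phi>) s"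
      using assms(1,2) s by (simp add: riemann_liouville_semigroup sub riemann_liouville_one)
    also have "\<dots> = riemann_liouville (1 - \<alpha>) (riemann_liouville \<alpha> \<psi>) s"
      using s by (intro riemann_liouville_cong eq) auto
    also have "\<dots> = integral {0..s} \<psi>"
      using assms(1,2) s by (simp add: riemann_liouville_semigroup sub riemann_liouville_one)
    finally show ?thesis .
  qed
  have "((\<lambda>s. integral {0..s} \<psi>) has_vector_derivative \<phi> t) (at t within {0..T})"
    using integral_has_vector_derivative[OF assms(4) t]
    by (rule has_vector_derivative_transform[OF t, rotated]) (simp add: int_eq)
  moreover have "((\<lambda>s. integral {0..s} \<psi>) has_vector_derivative \<psi> t) (at t within {0..T})"
    by (rule integral_has_vector_derivative[OF assms(5) t])
  ultimately show ?thesis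
    using assms(3) t vector_derivative_unique_within_closed_interval[of 0 T t] by simp
qed


section \<open>Partial fractional integrals on the box\<close>

abbreviation replace_coord :: "real^'n \<Rightarrow> 'n \<Rightarrow> real \<Rightarrow> real^'n" where
  "replace_coord x i \<xi> \<equiv> (\<chi> j. if j = i then \<xi> else x $ j)"

lemma replace_coord_mem_cbox:
  assumes "x \<in> cbox 0 b" "\<xi> \<in> {0..b $ i}"
  shows "replace_coord x i \<xi> \<in> cbox 0 b"
  using assms by (auto simp: mem_box_cart)

lemma scaleR_fun_apply: "(c *\<^sub>R f) x = c *\<^sub>R f x"
  by (simp add: scaleR_fun)

lemma replace_coord_self [simp]: "replace_coord x i (x $ i) = x"
  by (simp add: vec_eq_iff)

lemma cont_space_cong:
  assumes "f \<in> cont_space b" "g \<in> cont_space b" "\<And>x. x \<in> cbox 0 b \<Longrightarrow> f x = g x"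
  shows "f = g"
proof (rule ext)
  show "f x = g x" for x
    using assms by (cases "x \<in> cbox 0 b") (auto simp: cont_space_def)
qed

lemma cont_space_add: "f \<in> cont_space b \<Longrightarrow> g \<in> cont_space b \<Longrightarrow> f + g \<in> cont_space b"
  by (auto simp: cont_space_def plus_fun_def intro!: continuous_intros)

lemma cont_space_scaleR: "f \<in> cont_space b \<Longrightarrow> c *\<^sub>R f \<in> cont_space b"
  by (auto simp: cont_space_def scaleR_fun intro!: continuous_intros)

lemma continuous_on_slice:
  assumes "h \<in> cont_space b" "x \<in> cbox 0 b" "t \<le> b $ i"
  shows "continuous_on {0..t} (\<lambda>\<xi>. h (replace_coord x i \<xi>))"
proof (rule continuous_on_compose2[where g = h])
  show "continuous_on (cbox 0 b) h"
    using assms(1) by (simp add: cont_space_def)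
  show "continuous_on {0..t} (replace_coord x i)"
  proof (rule continuous_on_vec_lambda)
    show "continuous_on {0..t} (\<lambda>\<xi>. if j = i then \<xi> else x $ j)" for j
      by (cases "j = i") (auto intro: continuous_intros)
  qed
  show "replace_coord x i ` {0..t} \<subseteq> cbox 0 b"
    using assms by (auto intro!: replace_coord_mem_cbox)
qed

lemma RL_integral_eq_riemann_liouville:
  assumes "x \<in> cbox 0 b"
  shows "RL_integral b \<alpha> i h x = riemann_liouville \<alpha> (\<lambda>\<xi>. h (replace_coord x i \<xi>)) (x $ i)"
  using assms by (simp add: RL_integral_def riemann_liouville_def)

locale fractional_box =
  fixes b :: "real^'n" and \<alpha> :: real
  assumes order_pos: "0 < \<alpha>" and order_less_1: "\<alpha> < 1" and side_pos: "\<And>i. 0 < b $ i"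
begin

lemma RL_integral_add:
  assumes "h \<in> cont_space b" "k \<in> cont_space b"
  shows "RL_integral b \<alpha> i (h + k) = RL_integral b \<alpha> i h + RL_integral b \<alpha> i k"
proof (rule ext)
  fix x
  show "RL_integral b \<alpha> i (h + k) x = (RL_integral b \<alpha> i h + RL_integral b \<alpha> i k) x"
  proof (cases "x \<in> cbox 0 b")
    case True
    moreover from True have "0 \<le> x $ i" "x $ i \<le> b $ i" by (auto simp: mem_box_cart)
    ultimately show ?thesis
      using assms order_pos
      by (simp add: RL_integral_eq_riemann_liouville riemann_liouville_add continuous_on_slice)
  qed (simp add: RL_integral_def)
qed

lemma RL_integral_scaleR: "RL_integral b \<alpha> i (c *\<^sub>R h) = c *\<^sub>R RL_integral b \<alpha> i h"
proof (rule ext)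
  fix x
  show "RL_integral b \<alpha> i (c *\<^sub>R h) x = (c *\<^sub>R RL_integral b \<alpha> i h) x"
    by (cases "x \<in> cbox 0 b")
      (simp_all add: RL_integral_eq_riemann_liouville riemann_liouville_cmult scaleR_fun_apply,
        simp add: RL_integral_def)
qed

text \<open>
  In rescaled form the integrand depends jointly continuously on \<open>x\<close> and \<open>u\<close>, including on the
  face \<open>x\<^sub>i = 0\<close>, so the integral is continuous in the parameter \<open>x\<close>.
\<close>

lemma RL_integral_mem_cont_space:
  assumes h: "h \<in> cont_space b"
  shows "RL_integral b \<alpha> i h \<in> cont_space b"
proof -
  let ?r = "\<lambda>x u. replace_coord x i (x $ i * (1 - u powr (1 / \<alpha>)))"
  have "continuous_on (cbox 0 b) (\<lambda>x. integral (cbox 0 1) (\<lambda>u. h (?r x u)))"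
  proof (rule integral_continuous_on_param, unfold case_prod_unfold,
      rule continuous_on_compose2[where g = h])
    show "continuous_on (cbox 0 b) h"
      using h by (simp add: cont_space_def)
    show "continuous_on (cbox 0 b \<times> cbox 0 1) (\<lambda>p. ?r (fst p) (snd p))"
    proof (rule continuous_on_vec_lambda)
      fix j
      show "continuous_on (cbox 0 b \<times> cbox 0 1)
          (\<lambda>p. if j = i then fst p $ i * (1 - snd p powr (1 / \<alpha>)) else fst p $ j)"
        using order_pos by (cases "j = i") (auto intro!: continuous_intros continuous_on_powr')
    qed
    show "(\<lambda>p. ?r (fst p) (snd p)) ` (cbox 0 b \<times> cbox 0 1) \<subseteq> cbox 0 b"
    proof clarify
      fix x :: "real^'n" and u :: real
      assume x: "x \<in> cbox 0 b" and u: "u \<in> cbox 0 1"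
      have "0 \<le> x $ i" "x $ i \<le> b $ i" using x by (auto simp: mem_box_cart)
      then have "x $ i * (1 - u powr (1 / \<alpha>)) \<in> {0..b $ i}"
        using rescaled_arg_mem[OF order_pos, of "x $ i" u] u by auto
      then show "?r (fst (x, u)) (snd (x, u)) \<in> cbox 0 b"
        using x by (simp only: fst_conv snd_conv replace_coord_mem_cbox)
    qed
  qed
  moreover have "Gamma (\<alpha> + 1) \<noteq> 0"
    using order_pos by (intro less_imp_neq[symmetric] Gamma_real_pos) simp
  ultimately have "continuous_on (cbox 0 b) (\<lambda>x. (x $ i) powr \<alpha> / Gamma (\<alpha> + 1) *
      integral {0..1} (\<lambda>u. h (?r x u)))"
    using order_pos
    by (auto intro!: continuous_intros continuous_on_powr' simp: mem_box_cart)
  then have "continuous_on (cbox 0 b) (RL_integral b \<alpha> i h)"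
  proof (rule continuous_on_eq)
    fix x assume x: "x \<in> cbox 0 b"
    then have "0 \<le> x $ i" "x $ i \<le> b $ i" by (auto simp: mem_box_cart)
    then show "(x $ i) powr \<alpha> / Gamma (\<alpha> + 1) * integral {0..1} (\<lambda>u. h (?r x u))
        = RL_integral b \<alpha> i h x"
      using x order_pos h
      by (simp add: RL_integral_eq_riemann_liouville riemann_liouville_rescaled continuous_on_slice)
  qed
  then show ?thesis
    by (simp add: cont_space_def RL_integral_def)
qed

text \<open>
  Along a line parallel to the \<open>i\<close>-th axis the operator is the one-variable integral, so
  injectivity is inherited from \<open>riemann_liouville_inj\<close> line by line.
\<close>

lemma RL_integral_inj: "inj_on (RL_integral b \<alpha> i) (cont_space b)"
proof (rule inj_onI)
  fix h k assume h: "h \<in> cont_space b" and k: "k \<in> cont_space b"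
    and eq: "RL_integral b \<alpha> i h = RL_integral b \<alpha> i k"
  show "h = k"
  proof (rule cont_space_cong[OF h k])
    fix x assume x: "x \<in> cbox 0 b"
    have eq_slice: "riemann_liouville \<alpha> (\<lambda>\<xi>. h (replace_coord x i \<xi>)) t
        = riemann_liouville \<alpha> (\<lambda>\<xi>. k (replace_coord x i \<xi>)) t" if "0 \<le> t" "t \<le> b $ i" for t
    proof -
      have mem: "replace_coord x i t \<in> cbox 0 b"
        using x that by (intro replace_coord_mem_cbox) auto
      have shadow: "replace_coord (replace_coord x i t) i \<xi> = replace_coord x i \<xi>" for \<xi>
        by (simp add: vec_eq_iff)
      show ?thesis
        using fun_cong[OF eq, of "replace_coord x i t"]
        by (simp add: RL_integral_eq_riemann_liouville[OF mem] shadow)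
    qed
    have "x $ i \<in> {0..b $ i}"
      using x by (auto simp: mem_box_cart)
    from riemann_liouville_inj[OF order_pos order_less_1 side_pos
        continuous_on_slice[OF h x order_refl] continuous_on_slice[OF k x order_refl] eq_slice this]
    have "h (replace_coord x i (x $ i)) = k (replace_coord x i (x $ i))" by simp
    then show "h x = k x" by simp
  qed
qed

section \<open>Caputo derivatives and the tangent space\<close>

lemma anchored_space_eq_image: "anchored_space b \<alpha> i = RL_integral b \<alpha> i ` cont_space b"
  by (auto simp: anchored_space_def RL_integral_mem_cont_space)

lemma caputo_RL_integral:
  assumes "h \<in> cont_space b"
  shows "caputo b \<alpha> i (RL_integral b \<alpha> i h) = h"
  unfolding caputo_def using assms RL_integral_inj[of i] by (intro the_equality) (auto dest: inj_onD)

lemma anchored_space_add: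
  "f \<in> anchored_space b \<alpha> i \<Longrightarrow> g \<in> anchored_space b \<alpha> i \<Longrightarrow> f + g \<in> anchored_space b \<alpha> i"
  by (auto simp: anchored_space_eq_image RL_integral_add[symmetric] cont_space_add)

lemma anchored_space_scaleR: "f \<in> anchored_space b \<alpha> i \<Longrightarrow> c *\<^sub>R f \<in> anchored_space b \<alpha> i"
  by (auto simp: anchored_space_eq_image RL_integral_scaleR[symmetric] cont_space_scaleR)

lemma caputo_add:
  assumes "f \<in> anchored_space b \<alpha> i" "g \<in> anchored_space b \<alpha> i"
  shows "caputo b \<alpha> i (f + g) = caputo b \<alpha> i f + caputo b \<alpha> i g"
  using assms
  by (auto simp: anchored_space_eq_image RL_integral_add[symmetric] caputo_RL_integral cont_space_add)

lemma caputo_scaleR: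
  assumes "f \<in> anchored_space b \<alpha> i"
  shows "caputo b \<alpha> i (c *\<^sub>R f) = c *\<^sub>R caputo b \<alpha> i f"
  using assms
  by (auto simp: anchored_space_eq_image RL_integral_scaleR[symmetric] caputo_RL_integral cont_space_scaleR)

lemma caputo_at_RL_integral:
  "h \<in> cont_space b \<Longrightarrow> caputo_at b \<alpha> p i (RL_integral b \<alpha> i h) = h p"
  by (simp add: caputo_at_def anchored_space_eq_image caputo_RL_integral)

text \<open>
  A derivation is determined by its factor \<open>\<lambda>\<^sub>i\<close> because every anchored function is some
  \<open>I\<^sub>i\<^sup>\<alpha> h\<close>, on which the derivation takes the value \<open>\<lambda>\<^sub>i h(p)\<close>.
\<close>

lemma frac_derivations_eq_span:
  "frac_derivations b \<alpha> p i = range (\<lambda>c. c *\<^sub>R caputo_at b \<alpha> p i)"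
proof safe
  fix D assume "D \<in> frac_derivations b \<alpha> p i"
  then obtain l where D: "D \<in> alg_dual (anchored_space b \<alpha> i)"
    and l: "\<And>h. h \<in> cont_space b \<Longrightarrow> D (RL_integral b \<alpha> i h) = l * h p"
    by (auto simp: frac_derivations_def)
  have "D f = (l *\<^sub>R caputo_at b \<alpha> p i) f" for f
  proof (cases "f \<in> anchored_space b \<alpha> i")
    case True
    then obtain h where "h \<in> cont_space b" "f = RL_integral b \<alpha> i h"
      by (auto simp: anchored_space_eq_image)
    then show ?thesis by (simp add: scaleR_fun_apply l caputo_at_RL_integral)
  next
    case False
    then show ?thesis using D by (simp add: alg_dual_def scaleR_fun_apply caputo_at_def)
  qed
  then show "D \<in> range (\<lambda>c. c *\<^sub>R caputo_at b \<alpha> p i)" by blast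
next
  fix c
  have "c *\<^sub>R caputo_at b \<alpha> p i \<in> alg_dual (anchored_space b \<alpha> i)"
    by (auto simp: alg_dual_def scaleR_fun_apply caputo_at_def anchored_space_add anchored_space_scaleR
        caputo_add caputo_scaleR algebra_simps)
  moreover have "(c *\<^sub>R caputo_at b \<alpha> p i) (RL_integral b \<alpha> i h) = c * h p"
    if "h \<in> cont_space b" for h
    using that by (simp add: scaleR_fun_apply caputo_at_RL_integral)
  ultimately show "c *\<^sub>R caputo_at b \<alpha> p i \<in> frac_derivations b \<alpha> p i"
    by (auto simp: frac_derivations_def)
qed

text \<open>
  The constant \<open>1\<close> on the box is the Caputo derivative of its own fractional integral.
\<close>

lemma caputo_at_neq_0:
  assumes "p \<in> cbox 0 b"
  shows "caputo_at b \<alpha> p i \<noteq> 0"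
proof
  let ?h = "\<lambda>x. if x \<in> cbox 0 b then 1 else 0 :: real"
  have "?h \<in> cont_space b"
    by (auto simp: cont_space_def intro: continuous_on_eq[OF continuous_on_const[of _ 1]])
  then have "caputo_at b \<alpha> p i (RL_integral b \<alpha> i ?h) = 1"
    using assms by (simp add: caputo_at_RL_integral)
  moreover assume "caputo_at b \<alpha> p i = 0"
  ultimately show False by simp
qed

lemma tangent_combination_apply:
  "(\<Sum>i\<in>UNIV. c i *\<^sub>R tangent_basis b \<alpha> p i) j = c j *\<^sub>R caputo_at b \<alpha> p j"
proof -
  have sum_apply: "(\<Sum>i\<in>A. F i) j = (\<Sum>i\<in>A. F i j)"
    for A and F :: "'n \<Rightarrow> 'n \<Rightarrow> (real^'n \<Rightarrow> real) \<Rightarrow> real"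
    by (induction A rule: infinite_finite_induct) auto
  have "(\<Sum>i\<in>UNIV. c i *\<^sub>R tangent_basis b \<alpha> p i) j
      = (\<Sum>i\<in>UNIV. if i = j then c j *\<^sub>R caputo_at b \<alpha> p j else 0)"
    unfolding sum_apply
    by (intro sum.cong) (auto simp: tangent_basis_def scaleR_fun_apply)
  then show ?thesis by simp
qed

lemma tangent_space_eq_range:
  "tangent_space b \<alpha> p = range (\<lambda>c. \<Sum>i\<in>UNIV. c i *\<^sub>R tangent_basis b \<alpha> p i)"
proof safe
  fix v assume "v \<in> tangent_space b \<alpha> p"
  then have "\<forall>i. \<exists>c. v i = c *\<^sub>R caputo_at b \<alpha> p i"
    by (auto simp: tangent_space_def frac_derivations_eq_span)
  then obtain c where "\<And>i. v i = c i *\<^sub>R caputo_at b \<alpha> p i" by metis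
  then have "v = (\<Sum>i\<in>UNIV. c i *\<^sub>R tangent_basis b \<alpha> p i)"
    by (auto simp: fun_eq_iff[of v] tangent_combination_apply)
  then show "v \<in> range (\<lambda>c. \<Sum>i\<in>UNIV. c i *\<^sub>R tangent_basis b \<alpha> p i)" by blast
qed (auto simp: tangent_space_def frac_derivations_eq_span tangent_combination_apply)

lemma tangent_coeffs_combination:
  assumes "p \<in> cbox 0 b"
  shows "tangent_coeffs b \<alpha> p (\<Sum>i\<in>UNIV. c i *\<^sub>R tangent_basis b \<alpha> p i) = c"
  unfolding tangent_coeffs_def
proof (rule the_equality)
  fix d assume "(\<Sum>i\<in>UNIV. c i *\<^sub>R tangent_basis b \<alpha> p i) = (\<Sum>i\<in>UNIV. d i *\<^sub>R tangent_basis b \<alpha> p i)"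
  from fun_cong[OF this]
  have "c i *\<^sub>R caputo_at b \<alpha> p i = d i *\<^sub>R caputo_at b \<alpha> p i" for i
    by (simp only: tangent_combination_apply)
  then have "c i = d i" for i
    using caputo_at_neq_0[OF assms] by (meson scaleR_right_imp_eq)
  then show "d = c" by (intro ext) simp
qed (rule refl)

lemma tangent_functional_mem_alg_dual:
  "tangent_functional b \<alpha> p v \<in> alg_dual (common_anchored_space b \<alpha>)"
  by (auto simp: tangent_functional_def alg_dual_def common_anchored_space_def anchored_space_add
      anchored_space_scaleR caputo_add caputo_scaleR scaleR_fun_apply
      sum.distrib sum_distrib_left algebra_simps)

section \<open>Product functions and linear independence\<close>

definition product_function :: "('n \<Rightarrow> real \<Rightarrow> real) \<Rightarrow> real^'n \<Rightarrow> real" where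
  "product_function \<psi> x = (if x \<in> cbox 0 b then \<Prod>j\<in>UNIV. \<psi> j (x $ j) else 0)"

lemma product_function_mem_cont_space:
  assumes "\<And>j. continuous_on {0..b $ j} (\<psi> j)"
  shows "product_function \<psi> \<in> cont_space b"
proof -
  have "continuous_on (cbox 0 b) (\<lambda>x. \<Prod>j\<in>UNIV. \<psi> j (x $ j))"
    by (intro continuous_intros continuous_on_compose2[OF assms]) (auto simp: mem_box_cart)
  then have "continuous_on (cbox 0 b) (product_function \<psi>)"
    by (rule continuous_on_eq) (simp add: product_function_def)
  then show ?thesis by (simp add: cont_space_def product_function_def)
qed

text \<open>
  The factors that do not depend on \<open>x\<^sub>i\<close> are constants for the integration in the \<open>i\<close>-th variable.
\<close>

lemma RL_integral_product_function:
  "RL_integral b \<alpha> i (product_function \<psi>)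
    = product_function (\<psi>(i := riemann_liouville \<alpha> (\<psi> i)))"
proof (rule ext)
  fix x
  show "RL_integral b \<alpha> i (product_function \<psi>) x
      = product_function (\<psi>(i := riemann_liouville \<alpha> (\<psi> i))) x"
  proof (cases "x \<in> cbox 0 b")
    case True
    let ?P = "\<Prod>j\<in>UNIV - {i}. \<psi> j (x $ j)"
    have "product_function \<psi> (replace_coord x i \<xi>) = ?P * \<psi> i \<xi>" if "0 \<le> \<xi>" "\<xi> \<le> x $ i" for \<xi>
    proof -
      have "\<xi> \<in> {0..b $ i}" using True that by (auto simp: mem_box_cart intro: order_trans)
      then have "product_function \<psi> (replace_coord x i \<xi>)
          = (\<Prod>j\<in>UNIV. \<psi> j (replace_coord x i \<xi> $ j))"
        using replace_coord_mem_cbox[OF True] by (simp only: product_function_def if_True)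
      also have "\<dots> = \<psi> i \<xi> * (\<Prod>j\<in>UNIV - {i}. \<psi> j (replace_coord x i \<xi> $ j))"
        by (subst prod.remove[of _ i]) auto
      also have "(\<Prod>j\<in>UNIV - {i}. \<psi> j (replace_coord x i \<xi> $ j)) = ?P"
        by (intro prod.cong) auto
      finally show ?thesis by simp
    qed
    then have "RL_integral b \<alpha> i (product_function \<psi>) x = ?P * riemann_liouville \<alpha> (\<psi> i) (x $ i)"
      by (simp add: RL_integral_eq_riemann_liouville[OF True] riemann_liouville_cmult[symmetric]
          cong: riemann_liouville_cong)
    also have "\<dots> = product_function (\<psi>(i := riemann_liouville \<alpha> (\<psi> i))) x"
    proof -
      have "(\<Prod>j\<in>UNIV - {i}. (\<psi>(i := riemann_liouville \<alpha> (\<psi> i))) j (x $ j)) = ?P"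
        by (intro prod.cong) auto
      then show ?thesis
        using True by (simp add: product_function_def prod.remove[of UNIV i])
    qed
    finally show ?thesis .
  qed (simp add: RL_integral_def product_function_def)
qed

text \<open>
  Undoing the fractional integral in the \<open>i\<close>-th factor alone gives the preimage of the product
  under \<open>I\<^sub>i\<^sup>\<alpha>\<close>; this works in every direction \<open>i\<close> for the same function.
\<close>

lemma product_function_mem_common_anchored_space:
  assumes "\<And>j. continuous_on {0..b $ j} (\<phi> j)"
  shows "product_function (\<lambda>j. riemann_liouville \<alpha> (\<phi> j)) \<in> common_anchored_space b \<alpha>"
    and "caputo b \<alpha> i (product_function (\<lambda>j. riemann_liouville \<alpha> (\<phi> j)))
      = product_function ((\<lambda>j. riemann_liouville \<alpha> (\<phi> j))(i := \<phi> i))"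
proof -
  define h where "h i = product_function ((\<lambda>j. riemann_liouville \<alpha> (\<phi> j))(i := \<phi> i))" for i
  have h: "h i \<in> cont_space b" for i
    unfolding h_def using assms order_pos
    by (intro product_function_mem_cont_space) (auto intro: continuous_on_riemann_liouville)
  have eq: "product_function (\<lambda>j. riemann_liouville \<alpha> (\<phi> j)) = RL_integral b \<alpha> i (h i)" for i
    by (simp add: h_def RL_integral_product_function fun_upd_idem)
  show "product_function (\<lambda>j. riemann_liouville \<alpha> (\<phi> j)) \<in> common_anchored_space b \<alpha>"
    unfolding common_anchored_space_def using h eq by (auto simp: anchored_space_eq_image)
  show "caputo b \<alpha> i (product_function (\<lambda>j. riemann_liouville \<alpha> (\<phi> j)))
      = product_function ((\<lambda>j. riemann_liouville \<alpha> (\<phi> j))(i := \<phi> i))"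
    using caputo_RL_integral[OF h, of i i] unfolding eq[of i] h_def .
qed

text \<open>
  The weight \<open>p\<^sub>j - \<xi>\<close> vanishes at \<open>p\<^sub>j\<close>, which annihilates the derivative in direction \<open>j\<close>, while its
  fractional integral over \<open>[0, p\<^sub>j]\<close> stays positive, which keeps the derivative in direction \<open>i\<close>
  alive.
\<close>

lemma exists_dual_function:
  assumes p: "p \<in> cbox 0 b" and p_pos: "\<And>j. 0 < p $ j"
  obtains f where "f \<in> common_anchored_space b \<alpha>"
    and "\<And>k. caputo b \<alpha> k f p \<noteq> 0 \<longleftrightarrow> k = i"
proof -
  define \<phi> where "\<phi> j = (if j = i then \<lambda>_. 1 else (\<lambda>\<xi>. p $ j - \<xi>))" for j
  define \<psi> where "\<psi> j = riemann_liouville \<alpha> (\<phi> j)" for j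
  have cont: "continuous_on S (\<phi> j)" for j S
    by (auto simp: \<phi>_def intro!: continuous_intros)
  have \<psi>_pos: "\<psi> j (p $ j) > 0" if "j \<noteq> i" for j
  proof -
    (* Splitting p_j - \<xi> into the monomials p_j * \<xi>^0 and \<xi>^1 gives an explicit value, which is
       positive because Gamma (2 + \<alpha>) = (1 + \<alpha>) * Gamma (1 + \<alpha>) > Gamma (1 + \<alpha>). *)
    have "\<psi> j (p $ j) = riemann_liouville \<alpha> (\<lambda>\<xi>. p $ j * \<xi> ^ 0) (p $ j)
        - riemann_liouville \<alpha> (\<lambda>\<xi>. \<xi> ^ 1) (p $ j)"
      using that order_pos p_pos[of j]
      by (simp add: \<psi>_def \<phi>_def riemann_liouville_diff less_imp_le)
    also have "\<dots> = p $ j powr (1 + \<alpha>) * (1 / Gamma (1 + \<alpha>) - 1 / Gamma (2 + \<alpha>))"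
      using order_pos p_pos[of j]
      by (simp only: riemann_liouville_cmult riemann_liouville_power less_imp_le)
        (simp add: powr_add algebra_simps Gamma_numeral)
    also have "\<dots> > 0"
    proof -
      have "Gamma (2 + \<alpha>) = (1 + \<alpha>) * Gamma (1 + \<alpha>)"
      proof -
        have "Gamma ((1 + \<alpha>) + 1) = (1 + \<alpha>) * Gamma (1 + \<alpha>)"
          using order_pos by (intro Gamma_plus1) (auto elim!: nonpos_Ints_cases)
        then show ?thesis by (simp add: add_ac)
      qed
      moreover have "Gamma (1 + \<alpha>) > 0" using order_pos by (simp add: Gamma_real_pos)
      ultimately have "1 / Gamma (2 + \<alpha>) < 1 / Gamma (1 + \<alpha>)"
        using order_pos by (intro divide_strict_left_mono) auto
      then show ?thesis
        using p_pos[of j] by simp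
    qed
    finally show ?thesis .
  qed
  have caputo: "caputo b \<alpha> k (product_function \<psi>) p
      = \<phi> k (p $ k) * (\<Prod>j\<in>UNIV - {k}. \<psi> j (p $ j))" for k
  proof -
    have "(\<Prod>j\<in>UNIV - {k}. (\<psi>(k := \<phi> k)) j (p $ j)) = (\<Prod>j\<in>UNIV - {k}. \<psi> j (p $ j))"
      by (intro prod.cong) auto
    moreover have "caputo b \<alpha> k (product_function \<psi>) = product_function (\<psi>(k := \<phi> k))"
      using product_function_mem_common_anchored_space(2)[OF cont, where ?i = k] by (simp add: \<psi>_def[abs_def])
    ultimately show ?thesis
      using p by (simp add: product_function_def prod.remove[of UNIV k])
  qed
  show ?thesis
  proof
    show "product_function \<psi> \<in> common_anchored_space b \<alpha>"
      using product_function_mem_common_anchored_space(1)[OF cont] by (simp add: \<psi>_def[abs_def])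
    fix k
    have "(\<Prod>j\<in>UNIV - {i}. \<psi> j (p $ j)) \<noteq> 0"
      using \<psi>_pos by (force simp: prod_zero_iff)
    then show "caputo b \<alpha> k (product_function \<psi>) p \<noteq> 0 \<longleftrightarrow> k = i"
      by (cases "k = i") (auto simp: caputo \<phi>_def)
  qed
qed

lemma caputo_linearly_independent:
  assumes "p \<in> cbox 0 b" "\<And>j. 0 < p $ j"
    and vanish: "\<And>f. f \<in> common_anchored_space b \<alpha> \<Longrightarrow> (\<Sum>k\<in>UNIV. c k * caputo b \<alpha> k f p) = 0"
  shows "c i = 0"
proof -
  obtain f where f: "f \<in> common_anchored_space b \<alpha>"
    and dual: "\<And>k. caputo b \<alpha> k f p \<noteq> 0 \<longleftrightarrow> k = i"
    using exists_dual_function[OF assms(1,2)] by metis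
  have "(\<Sum>k\<in>UNIV. c k * caputo b \<alpha> k f p) = (\<Sum>k\<in>UNIV. if k = i then c i * caputo b \<alpha> i f p else 0)"
    using dual by (intro sum.cong) auto
  then have "c i * caputo b \<alpha> i f p = 0"
    using vanish[OF f] by simp
  then show "c i = 0" using dual[of i] by simp
qed

end

theorem proposition4p3:
  fixes \<alpha> :: real and b p :: "real^'n"
  assumes "0 < \<alpha>" and "\<alpha> < 1"
    and "\<And>i. 0 < b $ i"
    and "p \<in> cbox 0 b"
    and "\<And>i. 0 < p $ i"
  shows "(\<forall>v \<in> tangent_space b \<alpha> p.
            tangent_functional b \<alpha> p v \<in> alg_dual (common_anchored_space b \<alpha>))
    \<and> (\<forall>c :: 'n \<Rightarrow> real. (\<Sum>i\<in>UNIV. c i *\<^sub>R tangent_basis b \<alpha> p i) \<in> tangent_space b \<alpha> p \<and>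
          (\<forall>f \<in> common_anchored_space b \<alpha>.
            tangent_functional b \<alpha> p (\<Sum>i\<in>UNIV. c i *\<^sub>R tangent_basis b \<alpha> p i) f
              = (\<Sum>i\<in>UNIV. c i * caputo b \<alpha> i f p)))
    \<and> inj_on (tangent_functional b \<alpha> p) (tangent_space b \<alpha> p)
    \<and> (\<forall>c :: 'n \<Rightarrow> real.
          (\<forall>f \<in> common_anchored_space b \<alpha>. (\<Sum>i\<in>UNIV. c i * caputo b \<alpha> i f p) = 0)
            \<longrightarrow> (\<forall>i. c i = 0))"
proof -
  interpret fractional_box b \<alpha>
    using assms by unfold_locales
  let ?comb = "\<lambda>c. \<Sum>i\<in>UNIV. c i *\<^sub>R tangent_basis b \<alpha> p i"
  have eval: "tangent_functional b \<alpha> p (?comb c) f = (\<Sum>i\<in>UNIV. c i * caputo b \<alpha> i f p)"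
    if "f \<in> common_anchored_space b \<alpha>" for c f
    using that by (simp add: tangent_functional_def tangent_coeffs_combination[OF assms(4)])
  have indep: "c i = 0"
    if "\<forall>f \<in> common_anchored_space b \<alpha>. (\<Sum>i\<in>UNIV. c i * caputo b \<alpha> i f p) = 0" for c i
    using caputo_linearly_independent[OF assms(4,5)] that by blast
  have "inj_on (tangent_functional b \<alpha> p) (tangent_space b \<alpha> p)"
    unfolding tangent_space_eq_range
  proof (rule inj_onI, clarify)
    fix c d assume eq: "tangent_functional b \<alpha> p (?comb c) = tangent_functional b \<alpha> p (?comb d)"
    have "(\<Sum>i\<in>UNIV. (c i - d i) * caputo b \<alpha> i f p) = 0"
      if "f \<in> common_anchored_space b \<alpha>" for f
      using fun_cong[OF eq, of f] eval[OF that] by (simp add: left_diff_distrib sum_subtractf)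
    then have "c i - d i = 0" for i
      using indep[of "\<lambda>i. c i - d i"] by blast
    then show "?comb c = ?comb d" by simp
  qed
  then show ?thesis
    using tangent_functional_mem_alg_dual eval indep
    by (auto simp: tangent_space_eq_range)
qed

end
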